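(* Let $G=(V,E)$ be a graph, $b\in\mathbb{R}^V_{\ge0}$, $r\in\mathbb{R}^E_{\ge0}$, and let $x=Sequential(G,b,r,\lceil\log(5|E|+1)\rceil)$. Then $x$ is a $0.2$-tight feasible solution of the LP $\max\sum_{e\in E}x_e$ subject to $\sum_{e\in E(v)}x_e\le b_v$ ($v\in V$), $x_e\le r_e$ ($e\in E$), $x\ge0$.
   Context: $\log$ is base 2. $E(v)$ denotes the edges incident to $v$, $n=|V|$, $\bar{d}=2|E|/n$. For $x\in\mathbb{R}^E_{\ge0}$: $V^{loose}(x,\alpha)=\{v:\sum_{e\in E(v)}x_e<\alpha b_v\}$, $E^{loose}(x,\alpha)=\{e=\{u,v\}: x_e<\alpha r_e,\ u,v\in V^{loose}(x,\alpha)\}$, and $x$ is $\alpha$-tight if $E^{loose}(x,\alpha)=\emptyset$. The process $Sequential(G,b,r,T)$: draw independent thresholds $\mathcal{T}_{v,t}\sim\mathcal{U}[0.2b_v,0.4b_v]$; $q_v=0.8b_v/\max(|E(v)|,\bar d)$; $x_{e,0}=\min(r_e,q_u,q_v)$ for $e=\{u,v\}$; $V_0^{active}=V$; for $t=1,\dots,T$: $y_{v,t-1}=\sum_{e\in E(v)}x_{e,t-1}$, $V_t^{active}=\{v\in V_{t-1}^{active}: y_{v,t-1}\le\mathcal{T}_{v,t}\}$, $E_t^{active}=\{e=\{u,v\}: u,v\in V_t^{active},\ x_{e,t-1}\le r_e/2\}$, $x_{e,t}=2x_{e,t-1}$ if $e\in E_t^{active}$ else $x_{e,t-1}$. Output $x_e=x_{e,T}$.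 *)

theory Defs
  imports "HOL-Probability.Probability"
begin

definition simple_graph :: "'v set \<Rightarrow> 'v set set \<Rightarrow> bool" where
  "simple_graph V E \<longleftrightarrow> finite V \<and> (\<forall>e\<in>E. \<exists>u\<in>V. \<exists>v\<in>V. u \<noteq> v \<and> e = {u, v})"

definition incident_edges :: "'v set set \<Rightarrow> 'v \<Rightarrow> 'v set set" where
  "incident_edges E v = {e \<in> E. v \<in> e}"

definition avg_degree :: "'v set \<Rightarrow> 'v set set \<Rightarrow> real" where
  "avg_degree V E = 2 * real (card E) / real (card V)"

definition lp_feasible ::
  "'v set \<Rightarrow> 'v set set \<Rightarrow> ('v \<Rightarrow> real) \<Rightarrow> ('v set \<Rightarrow> real) \<Rightarrow> ('v set \<Rightarrow> real) \<Rightarrow> bool" where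
  "lp_feasible V E b r x \<longleftrightarrow>
     (\<forall>v\<in>V. (\<Sum>e\<in>incident_edges E v. x e) \<le> b v) \<and>
     (\<forall>e\<in>E. x e \<le> r e) \<and>
     (\<forall>e\<in>E. 0 \<le> x e)"

definition loose_vertices ::
  "'v set \<Rightarrow> 'v set set \<Rightarrow> ('v \<Rightarrow> real) \<Rightarrow> ('v set \<Rightarrow> real) \<Rightarrow> real \<Rightarrow> 'v set" where
  "loose_vertices V E b x \<alpha> = {v \<in> V. (\<Sum>e\<in>incident_edges E v. x e) < \<alpha> * b v}"

definition loose_edges ::
  "'v set \<Rightarrow> 'v set set \<Rightarrow> ('v \<Rightarrow> real) \<Rightarrow> ('v set \<Rightarrow> real) \<Rightarrow> ('v set \<Rightarrow> real) \<Rightarrow> real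
    \<Rightarrow> 'v set set" where
  "loose_edges V E b r x \<alpha> = {e \<in> E. x e < \<alpha> * r e \<and> e \<subseteq> loose_vertices V E b x \<alpha>}"

definition lp_tight ::
  "'v set \<Rightarrow> 'v set set \<Rightarrow> ('v \<Rightarrow> real) \<Rightarrow> ('v set \<Rightarrow> real) \<Rightarrow> real \<Rightarrow> ('v set \<Rightarrow> real) \<Rightarrow> bool" where
  "lp_tight V E b r \<alpha> x \<longleftrightarrow> loose_edges V E b r x \<alpha> = {}"

definition seq_q :: "'v set \<Rightarrow> 'v set set \<Rightarrow> ('v \<Rightarrow> real) \<Rightarrow> 'v \<Rightarrow> real" where
  "seq_q V E b v = 0.8 * b v / max (real (card (incident_edges E v))) (avg_degree V E)"

definition seq_init ::
  "'v set \<Rightarrow> 'v set set \<Rightarrow> ('v \<Rightarrow> real) \<Rightarrow> ('v set \<Rightarrow> real) \<Rightarrow> 'v set \<Rightarrow> real" where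
  "seq_init V E b r e = min (r e) (Min (seq_q V E b ` e))"

text \<open>The state after round \<open>t\<close> consists of the edge values \<open>x\<^sub>t\<close> and the active vertices; the
  thresholds are \<open>\<tau> v t\<close> with rounds numbered from 1.\<close>

primrec seq_state ::
  "'v set \<Rightarrow> 'v set set \<Rightarrow> ('v \<Rightarrow> real) \<Rightarrow> ('v set \<Rightarrow> real) \<Rightarrow> ('v \<Rightarrow> nat \<Rightarrow> real) \<Rightarrow> nat
    \<Rightarrow> ('v set \<Rightarrow> real) \<times> 'v set" where
  "seq_state V E b r \<tau> 0 = (seq_init V E b r, V)"
| "seq_state V E b r \<tau> (Suc t) =
     (let (x, A) = seq_state V E b r \<tau> t;
          A' = {v \<in> A. (\<Sum>e\<in>incident_edges E v. x e) \<le> \<tau> v (Suc t)};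
          F = {e \<in> E. e \<subseteq> A' \<and> x e \<le> r e / 2}
      in ((\<lambda>e. if e \<in> F then 2 * x e else x e), A'))"

definition sequential ::
  "'v set \<Rightarrow> 'v set set \<Rightarrow> ('v \<Rightarrow> real) \<Rightarrow> ('v set \<Rightarrow> real) \<Rightarrow> ('v \<Rightarrow> nat \<Rightarrow> real) \<Rightarrow> nat
    \<Rightarrow> 'v set \<Rightarrow> real" where
  "sequential V E b r \<tau> T = fst (seq_state V E b r \<tau> T)"

text \<open>The uniform distribution on \<open>[l, u]\<close>. For \<open>l = u\<close> it is the point mass at \<open>l\<close>; this case
  arises for vertices with \<open>b v = 0\<close>.\<close>

definition uniform_interval :: "real \<Rightarrow> real \<Rightarrow> real measure" where
  "uniform_interval l u = (if l < u then uniform_measure lborel {l..u} else return borel l)"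

definition random_thresholds ::
  "'w measure \<Rightarrow> 'v set \<Rightarrow> ('v \<Rightarrow> real) \<Rightarrow> nat \<Rightarrow> ('v \<Rightarrow> nat \<Rightarrow> 'w \<Rightarrow> real) \<Rightarrow> bool" where
  "random_thresholds M V b T \<T> \<longleftrightarrow>
     prob_space M \<and>
     prob_space.indep_vars M (\<lambda>_. borel) (\<lambda>(v, t). \<T> v t) (V \<times> {1..T}) \<and>
     (\<forall>v\<in>V. \<forall>t\<in>{1..T}. distr M borel (\<T> v t) = uniform_interval (0.2 * b v) (0.4 * b v))"

end

theory Submission
  imports Defs
begin

text \<open>A vertex that doubles its incident edges has load at most \<open>0.4 b\<close> beforehand, hence at most
  \<open>0.8 b\<close> afterwards; this gives feasibility. For tightness, loads never decrease, so both endpoints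
  of an edge that is loose at the end were below their thresholds in every round and the edge was
  doubled \<open>T\<close> times. As \<open>2 ^ T \<ge> 5 |E| + 1\<close> and the initial value is at least
  \<open>min (r e) (0.8 b v / |E|)\<close> for one endpoint \<open>v\<close>, its final value is too large for it to be loose.\<close>

lemma simple_graph_finite_edges:
  assumes "simple_graph V E"
  shows "finite E"
proof -
  have "E \<subseteq> Pow V" "finite V"
    using assms by (auto simp: simple_graph_def)
  then show ?thesis
    by (meson finite_Pow_iff finite_subset)
qed

section \<open>Almost sure bounds on the thresholds\<close>

lemma AE_uniform_interval:
  assumes "l \<le> u"
  shows "AE y in uniform_interval l u. y \<in> {l..u}"
proof (cases "l < u")
  case True
  then show ?thesis
    unfolding uniform_interval_def
    by (auto intro!: AE_uniform_measureI)
next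
  case False
  have "AE y in return borel l. y \<in> {l..u}"
    using assms by (subst AE_return) auto
  with False show ?thesis
    by (simp only: uniform_interval_def if_False)
qed

text \<open>Each single bound is pulled back from the law of the threshold to \<open>M\<close>.
  There are only finitely many pairs \<open>(v, t)\<close>, so one null set serves for all of
  them.\<close>

lemma random_thresholds_AE_bounds:
  assumes "random_thresholds M V b T \<T>" and "finite V" and "\<forall>v\<in>V. 0 \<le> b v"
  shows "AE \<omega> in M. \<forall>v\<in>V. \<forall>t\<in>{1..T}. \<T> v t \<omega> \<in> {0.2 * b v..0.4 * b v}"
proof -
  interpret prob_space M
    using assms(1) by (simp add: random_thresholds_def)
  have "AE \<omega> in M. \<T> v t \<omega> \<in> {0.2 * b v..0.4 * b v}" if "v \<in> V" "t \<in> {1..T}" for v t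
  proof -
    have "random_variable borel (case (v, t) of (v, t) \<Rightarrow> \<T> v t)"
      using assms(1) that unfolding random_thresholds_def indep_vars_def by blast
    then have meas: "\<T> v t \<in> borel_measurable M"
      by simp
    have "distr M borel (\<T> v t) = uniform_interval (0.2 * b v) (0.4 * b v)"
      using assms(1) that unfolding random_thresholds_def by blast
    moreover have "0.2 * b v \<le> 0.4 * b v"
      using assms(3) that by simp
    ultimately have "AE y in distr M borel (\<T> v t). y \<in> {0.2 * b v..0.4 * b v}"
      using AE_uniform_interval by metis
    then show ?thesis
      using meas by (simp add: AE_distr_iff)
  qed
  then show ?thesis
    using assms(2) by (simp add: AE_finite_all)
qed

text \<open>Fixes one outcome of the thresholds. Once they lie in their intervals, feasibility and
  tightness are deterministic statements.\<close>

locale sequential_run =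
  fixes V :: "'v set" and E :: "'v set set"
    and b :: "'v \<Rightarrow> real" and r :: "'v set \<Rightarrow> real"
    and \<tau> :: "'v \<Rightarrow> nat \<Rightarrow> real" and T :: nat
  assumes graph: "simple_graph V E"
    and b_nonneg: "v \<in> V \<Longrightarrow> 0 \<le> b v"
    and r_nonneg: "e \<in> E \<Longrightarrow> 0 \<le> r e"
    and threshold: "v \<in> V \<Longrightarrow> t \<in> {1..T} \<Longrightarrow> \<tau> v t \<in> {0.2 * b v..0.4 * b v}"
begin

abbreviation xval :: "nat \<Rightarrow> 'v set \<Rightarrow> real" where
  "xval t \<equiv> fst (seq_state V E b r \<tau> t)"

abbreviation active :: "nat \<Rightarrow> 'v set" where
  "active t \<equiv> snd (seq_state V E b r \<tau> t)"

abbreviation load :: "nat \<Rightarrow> 'v \<Rightarrow> real" where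
  "load t v \<equiv> (\<Sum>e\<in>incident_edges E v. xval t e)"

section \<open>Invariants of the dynamics\<close>

lemma active_Suc: "active (Suc t) = {v \<in> active t. load t v \<le> \<tau> v (Suc t)}"
  by (simp add: Let_def split_beta)

lemma xval_Suc:
  "xval (Suc t) e =
    (if e \<in> E \<and> e \<subseteq> active (Suc t) \<and> xval t e \<le> r e / 2 then 2 * xval t e else xval t e)"
  by (simp add: Let_def split_beta)

declare seq_state.simps(2) [simp del]

lemma finite_incident_edges: "finite (incident_edges E v)"
  using simple_graph_finite_edges[OF graph] by (simp add: incident_edges_def)

lemma edge_finite_nonempty:
  assumes "e \<in> E"
  shows "finite e" "e \<noteq> {}" "e \<subseteq> V"
  using assms graph by (auto simp: simple_graph_def)

lemma seq_q_nonneg: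
  assumes "v \<in> V"
  shows "0 \<le> seq_q V E b v"
  using b_nonneg[OF assms] by (simp add: seq_q_def)

lemma xval_nonneg:
  assumes "e \<in> E"
  shows "0 \<le> xval t e"
proof (induction t)
  case 0
  show ?case
    using edge_finite_nonempty[OF assms] r_nonneg[OF assms] seq_q_nonneg
    by (auto simp: seq_init_def)
next
  case (Suc t)
  then show ?case
    by (simp add: xval_Suc)
qed

text \<open>An edge is doubled only while its value is at most half its capacity.\<close>

lemma xval_le_capacity:
  assumes "e \<in> E"
  shows "xval t e \<le> r e"
  by (induction t) (simp_all add: seq_init_def xval_Suc)

lemma xval_mono:
  assumes "e \<in> E" "s \<le> t"
  shows "xval s e \<le> xval t e"
  using assms(2)
proof (rule lift_Suc_mono_le[rotated])
  show "xval n e \<le> xval (Suc n) e" for n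
    using xval_nonneg[OF assms(1), of n] by (simp add: xval_Suc)
qed

lemma load_mono:
  assumes "s \<le> t"
  shows "load s v \<le> load t v"
  using assms by (intro sum_mono xval_mono) (auto simp: incident_edges_def)

lemma xval_le_load:
  assumes "e \<in> E" "v \<in> e"
  shows "xval t e \<le> load t v"
  using assms xval_nonneg finite_incident_edges
  by (intro member_le_sum) (auto simp: incident_edges_def)

section \<open>Feasibility\<close>

lemma load_init_le:
  assumes "v \<in> V"
  shows "load 0 v \<le> 0.8 * b v"
proof -
  let ?d = "real (card (incident_edges E v))"
  let ?m = "max ?d (avg_degree V E)"
  have "xval 0 e \<le> seq_q V E b v" if "e \<in> incident_edges E v" for e
    using that edge_finite_nonempty[of e]
    by (auto simp: seq_init_def incident_edges_def intro!: min.coboundedI2 Min_le)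
  then have "load 0 v \<le> ?d * seq_q V E b v"
    by (metis sum_bounded_above)
  also have "\<dots> = 0.8 * b v * (?d / ?m)"
    by (simp add: seq_q_def)
  \<comment> \<open>The denominator is at least the degree. If it is 0, the quotient is 0 by
    convention and the bound persists.\<close>
  also have "\<dots> \<le> 0.8 * b v * 1"
    using b_nonneg[OF assms] by (intro mult_left_mono) (auto simp: divide_le_eq_1)
  finally show ?thesis by simp
qed

lemma load_le:
  assumes "v \<in> V" "t \<le> T"
  shows "load t v \<le> 0.8 * b v"
  using assms(2)
proof (induction t)
  case 0
  show ?case
    using load_init_le[OF assms(1)] .
next
  case (Suc t)
  show ?case
  proof (cases "v \<in> active (Suc t)")
    case True
    have "load (Suc t) v \<le> (\<Sum>e\<in>incident_edges E v. 2 * xval t e)"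
      using xval_nonneg by (intro sum_mono) (auto simp: xval_Suc incident_edges_def)
    also have "\<dots> = 2 * load t v"
      by (simp add: sum_distrib_left)
    also have "\<dots> \<le> 2 * \<tau> v (Suc t)"
      using True by (simp add: active_Suc)
    also have "\<dots> \<le> 0.8 * b v"
      using threshold[OF assms(1), of "Suc t"] Suc.prems by simp
    finally show ?thesis .
  next
    case False
    \<comment> \<open>Doubling an edge requires both endpoints to be active, so every edge at an
      inactive vertex is frozen.\<close>
    have "load (Suc t) v = load t v"
      using False by (intro sum.cong) (auto simp: xval_Suc incident_edges_def)
    then show ?thesis
      using Suc by simp
  qed
qed

lemma feasible: "lp_feasible V E b r (sequential V E b r \<tau> T)"
proof -
  have "load T v \<le> b v" if "v \<in> V" for v
    using load_le[OF that order_refl] b_nonneg[OF that] by simp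
  then show ?thesis
    by (simp add: lp_feasible_def sequential_def xval_nonneg xval_le_capacity)
qed

section \<open>Tightness\<close>

lemma loose_vertex_active:
  assumes "v \<in> V" "load T v < 0.2 * b v" "t \<le> T"
  shows "v \<in> active t"
  using assms(3)
proof (induction t)
  case 0
  show ?case using assms(1) by simp
next
  case (Suc t)
  have "load t v \<le> load T v"
    using Suc.prems by (intro load_mono) simp
  \<comment> \<open>The looseness factor 0.2 is the lower end of the threshold interval, so a loose
    vertex passes the test whatever threshold is drawn.\<close>
  also have "\<dots> \<le> \<tau> v (Suc t)"
    using assms(2) threshold[OF assms(1), of "Suc t"] Suc.prems by simp
  finally show ?case
    using Suc by (simp add: active_Suc)
qed

lemma loose_edge_doubles:
  assumes "e \<in> E" "xval T e < 0.2 * r e" "\<And>v. v \<in> e \<Longrightarrow> load T v < 0.2 * b v" "t \<le> T"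
  shows "xval t e = 2 ^ t * xval 0 e"
  using assms(4)
proof (induction t)
  case 0
  show ?case by simp
next
  case (Suc t)
  have "e \<subseteq> active (Suc t)"
    using assms edge_finite_nonempty(3)[of e] Suc.prems loose_vertex_active by blast
  \<comment> \<open>The capacity test is passed as well: by monotonicity the value is still below
    \<open>0.2 * r e\<close>.\<close>
  moreover have "xval t e \<le> r e / 2"
    using xval_mono[OF assms(1), of t T] assms(2) r_nonneg[OF assms(1)] Suc.prems by simp
  ultimately show ?case
    using Suc assms(1) by (simp add: xval_Suc)
qed

text \<open>An edge has two distinct endpoints, so there are at least two vertices and the average
  degree is at most the number of edges.\<close>

lemma degree_bound_le_card_edges:
  assumes "e \<in> E"
  shows "max (real (card (incident_edges E v))) (avg_degree V E) \<le> real (card E)"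
proof -
  have "card (incident_edges E v) \<le> card E"
    using simple_graph_finite_edges[OF graph]
    by (intro card_mono) (auto simp: incident_edges_def)
  moreover have "2 \<le> card V"
  proof -
    obtain u w where "u \<in> V" "w \<in> V" "u \<noteq> w"
      using assms graph by (auto simp: simple_graph_def)
    then have "card {u, w} \<le> card V"
      using graph by (intro card_mono) (auto simp: simple_graph_def)
    then show ?thesis using \<open>u \<noteq> w\<close> by simp
  qed
  then have "2 * real (card E) / real (card V) \<le> 2 * real (card E) / 2"
    by (intro divide_left_mono) auto
  ultimately show ?thesis
    by (simp add: avg_degree_def)
qed

lemma seq_q_lower_bound:
  assumes "e \<in> E" "v \<in> e"
  shows "0.8 * b v \<le> real (card E) * seq_q V E b v"
proof -
  let ?m = "max (real (card (incident_edges E v))) (avg_degree V E)"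
  have "v \<in> V"
    using assms edge_finite_nonempty(3) by blast
  \<comment> \<open>The edge \<open>e\<close> itself makes the degree positive, so the division in
    \<open>seq_q\<close> can be cancelled.\<close>
  have "0 < card (incident_edges E v)"
    using assms finite_incident_edges by (auto simp: card_gt_0_iff incident_edges_def)
  then have "0 < ?m" by simp
  then have "0.8 * b v = ?m * seq_q V E b v"
    by (simp add: seq_q_def)
  also have "\<dots> \<le> real (card E) * seq_q V E b v"
    using degree_bound_le_card_edges[OF assms(1)] seq_q_nonneg[OF \<open>v \<in> V\<close>]
    by (rule mult_right_mono)
  finally show ?thesis .
qed

lemma tight:
  assumes "5 * real (card E) + 1 \<le> 2 ^ T"
  shows "lp_tight V E b r 0.2 (sequential V E b r \<tau> T)"
proof (rule ccontr)
  assume "\<not> ?thesis"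
  then obtain e where e: "e \<in> E" "xval T e < 0.2 * r e" "\<And>v. v \<in> e \<Longrightarrow> load T v < 0.2 * b v"
    by (auto simp: lp_tight_def loose_edges_def loose_vertices_def sequential_def)
  have "5 * real (card E) * xval 0 e \<le> 2 ^ T * xval 0 e"
    using assms by (intro mult_right_mono xval_nonneg e(1)) auto
  also have "\<dots> = xval T e"
    using loose_edge_doubles[OF e order_refl] by simp
  finally have growth: "5 * real (card E) * xval 0 e \<le> xval T e" .
  have "Min (seq_q V E b ` e) \<in> seq_q V E b ` e"
    using edge_finite_nonempty[OF e(1)] by (intro Min_in) auto
  moreover have "xval 0 e \<in> {r e, Min (seq_q V E b ` e)}"
    by (simp add: seq_init_def min_def)
  ultimately consider "xval 0 e = r e" | v where "v \<in> e" "xval 0 e = seq_q V E b v"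
    by fastforce
  then show False
  proof cases
    case 1
    \<comment> \<open>An edge that starts at its capacity never drops below it, hence is not
      loose.\<close>
    then show False
      using xval_mono[OF e(1), of 0 T] e(2) r_nonneg[OF e(1)] by simp
  next
    case 2
    \<comment> \<open>Here 4 is 5 times 0.8. The growth of this edge alone would push the load of
      \<open>v\<close> to \<open>4 * b v\<close>, against a load below
      \<open>0.2 * b v\<close>.\<close>
    have "4 * b v \<le> 5 * real (card E) * xval 0 e"
      using seq_q_lower_bound[OF e(1) 2(1)] 2(2) by simp
    also have "\<dots> \<le> load T v"
      using growth xval_le_load[OF e(1) 2(1), of T] by linarith
    also have "\<dots> < 0.2 * b v"
      using e(3)[OF 2(1)] .
    finally show False
      using b_nonneg[of v] edge_finite_nonempty(3)[OF e(1)] 2(1) by auto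
  qed
qed

end

section \<open>Number of rounds and return to random thresholds\<close>

lemma le_two_power_ceiling_log:
  fixes a :: real
  assumes "1 \<le> a"
  shows "a \<le> 2 ^ nat \<lceil>log 2 a\<rceil>"
proof -
  have "a = 2 powr (log 2 a)"
    using assms by simp
  also have "\<dots> \<le> 2 powr real (nat \<lceil>log 2 a\<rceil>)"
    by (intro powr_mono real_nat_ceiling_ge) simp
  also have "\<dots> = 2 ^ nat \<lceil>log 2 a\<rceil>"
    by (simp add: powr_realpow)
  finally show ?thesis .
qed

theorem theorem3p6:
  fixes V :: "'v set" and E :: "'v set set"
    and b :: "'v \<Rightarrow> real" and r :: "'v set \<Rightarrow> real"
    and M :: "'w measure" and \<T> :: "'v \<Rightarrow> nat \<Rightarrow> 'w \<Rightarrow> real"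
    and T :: nat and x :: "'w \<Rightarrow> 'v set \<Rightarrow> real"
  assumes "simple_graph V E"
    and "\<forall>v\<in>V. 0 \<le> b v"
    and "\<forall>e\<in>E. 0 \<le> r e"
    and "T = nat \<lceil>log 2 (5 * real (card E) + 1)\<rceil>"
    and "random_thresholds M V b T \<T>"
    and "\<forall>\<omega>. x \<omega> = sequential V E b r (\<lambda>v t. \<T> v t \<omega>) T"
  shows "(\<forall>\<omega>\<in>space M.
            (\<forall>v\<in>V. \<forall>t\<in>{1..T}. \<T> v t \<omega> \<in> {0.2 * b v..0.4 * b v}) \<longrightarrow>
            lp_tight V E b r 0.2 (x \<omega>) \<and> lp_feasible V E b r (x \<omega>))
       \<and> (AE \<omega> in M. lp_tight V E b r 0.2 (x \<omega>) \<and> lp_feasible V E b r (x \<omega>))"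
proof -
  have det: "lp_tight V E b r 0.2 (x \<omega>) \<and> lp_feasible V E b r (x \<omega>)"
    if "\<forall>v\<in>V. \<forall>t\<in>{1..T}. \<T> v t \<omega> \<in> {0.2 * b v..0.4 * b v}" for \<omega>
  proof -
    interpret sequential_run V E b r "\<lambda>v t. \<T> v t \<omega>" T
      using assms(1-3) that by unfold_locales auto
    \<comment> \<open>The summand 1 keeps the argument of the logarithm at least 1 even without
      edges.\<close>
    have "5 * real (card E) + 1 \<le> 2 ^ T"
      unfolding assms(4) by (rule le_two_power_ceiling_log) simp
    then show ?thesis
      using tight feasible assms(6) by simp
  qed
  have "finite V"
    using assms(1) by (simp add: simple_graph_def)
  then have "AE \<omega> in M. \<forall>v\<in>V. \<forall>t\<in>{1..T}. \<T> v t \<omega> \<in> {0.2 * b v..0.4 * b v}"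
    using random_thresholds_AE_bounds assms(2,5) by blast
  then have "AE \<omega> in M. lp_tight V E b r 0.2 (x \<omega>) \<and> lp_feasible V E b r (x \<omega>)"
    by eventually_elim (rule det)
  with det show ?thesis
    by blast
qed

end
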